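(* Let $\mathfrak{g}=\mathfrak{s}\oplus\mathfrak{r}$ be a seven-dimensional real Lie algebra which is the product (direct sum of Lie algebras) of a semisimple Lie algebra $\mathfrak{s}$ with $\dim(\mathfrak{s})=3$ and a solvable Lie algebra $\mathfrak{r}$ with $\dim(\mathfrak{r})=4$, and assume that the center $\mathfrak{z}(\mathfrak{r})$ of $\mathfrak{r}$ is non-trivial. Then $\mathfrak{g}$ does not admit any closed $\mathrm{G}_2$-structure.
   Context: All Lie algebras are real and finite-dimensional; $d$ denotes the Chevalley-Eilenberg differential of $\mathfrak{g}$ (on $1$-forms $d\alpha(x,y)=-\alpha([x,y])$, extended to $\Lambda^*(\mathfrak{g}^* )$ as a graded derivation). $\mathrm{G}_2$-structures. Let $\dim\mathfrak{g}=7$. For $\phi\in\Lambda^3(\mathfrak{g}^* )$ let $b_\phi:\mathfrak{g}\times\mathfrak{g}\to\Lambda^7(\mathfrak{g}^* )$ be the symmetric bilinear map $b_\phi(v,w)=\frac16\,\iota_v\phi\wedge\iota_w\phi\wedge\phi$. Its determinant has a well-defined ninth root $\det(b_\phi)^{1/9}\in\Lambda^7(\mathfrak{g}^* )$: if in a basis one writes $b_\phi(e_i,e_j)=B_{ij}\,e^1\wedge\cdots\wedge e^7$, then $\det(b_\phi)^{1/9}=\det(B)^{1/9}e^1\wedge\cdots\wedge e^7$ (real ninth root). The form $\phi$ is stable if $\det(b_\phi)^{1/9}\neq0$ (equivalently, its $\mathrm{GL}(\mathfrak{g})$-orbit is open in $\Lambda^3(\mathfrak{g}^* )$). A $\mathrm{G}_2$-structure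 on $\mathfrak{g}$ is a stable $3$-form $\varphi$ such that the bilinear form $g_\varphi=\det(b_\varphi)^{-1/9}b_\varphi:\mathfrak{g}\times\mathfrak{g}\to\mathbb{R}$ is positive definite. It is closed if $d\varphi=0$. *)

theory Defs
  imports Complex_Main "HOL-Combinatorics.Permutations" "Jordan_Normal_Form.Determinant"
begin

section \<open>Lie algebras\<close>

text \<open>A Lie algebra is a bracket on a whole real vector space type. Its dimension is \<open>dim UNIV\<close>;
  since \<open>dim\<close> is \<open>0\<close> for spaces without a finite basis, \<open>dim UNIV = 7\<close> includes finite
  dimensionality.\<close>

locale lie_algebra =
  fixes br :: "'a::real_vector \<Rightarrow> 'a \<Rightarrow> 'a"
  assumes linear_left: "linear (\<lambda>x. br x y)"
    and linear_right: "linear (br x)"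
    and self: "br x x = 0"
    and jacobi: "br x (br y z) + br y (br z x) + br z (br x y) = 0"

definition lie_subalgebra :: "('a::real_vector \<Rightarrow> 'a \<Rightarrow> 'a) \<Rightarrow> 'a set \<Rightarrow> bool" where
  "lie_subalgebra br U \<longleftrightarrow> subspace U \<and> (\<forall>x\<in>U. \<forall>y\<in>U. br x y \<in> U)"

definition lie_ideal :: "('a::real_vector \<Rightarrow> 'a \<Rightarrow> 'a) \<Rightarrow> 'a set \<Rightarrow> 'a set \<Rightarrow> bool" where
  "lie_ideal br U I \<longleftrightarrow> subspace I \<and> I \<subseteq> U \<and> (\<forall>x\<in>U. \<forall>y\<in>I. br x y \<in> I)"

fun derived_series :: "('a::real_vector \<Rightarrow> 'a \<Rightarrow> 'a) \<Rightarrow> 'a set \<Rightarrow> nat \<Rightarrow> 'a set" where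
  "derived_series br U 0 = U"
| "derived_series br U (Suc n) =
     span {br x y | x y. x \<in> derived_series br U n \<and> y \<in> derived_series br U n}"

definition lie_solvable :: "('a::real_vector \<Rightarrow> 'a \<Rightarrow> 'a) \<Rightarrow> 'a set \<Rightarrow> bool" where
  "lie_solvable br U \<longleftrightarrow> (\<exists>n. derived_series br U n = {0})"

text \<open>Semisimple: the radical (the largest solvable ideal) is zero.\<close>

definition lie_semisimple :: "('a::real_vector \<Rightarrow> 'a \<Rightarrow> 'a) \<Rightarrow> 'a set \<Rightarrow> bool" where
  "lie_semisimple br U \<longleftrightarrow> (\<forall>I. lie_ideal br U I \<and> lie_solvable br I \<longrightarrow> I = {0})"

definition lie_center :: "('a::real_vector \<Rightarrow> 'a \<Rightarrow> 'a) \<Rightarrow> 'a set \<Rightarrow> 'a set" where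
  "lie_center br U = {x \<in> U. \<forall>y\<in>U. br x y = 0}"

definition lie_direct_sum :: "('a::real_vector \<Rightarrow> 'a \<Rightarrow> 'a) \<Rightarrow> 'a set \<Rightarrow> 'a set \<Rightarrow> bool" where
  "lie_direct_sum br S R \<longleftrightarrow>
     lie_subalgebra br S \<and> lie_subalgebra br R \<and>
     (\<forall>x\<in>S. \<forall>y\<in>R. br x y = 0) \<and>
     S \<inter> R = {0} \<and> {x + y | x y. x \<in> S \<and> y \<in> R} = UNIV"

section \<open>Exterior forms\<close>

text \<open>A form of degree \<open>k\<close> is an alternating multilinear function on lists of length \<open>k\<close>,
  extended by zero to lists of other lengths.\<close>

type_synonym 'a form = "'a list \<Rightarrow> real"

definition alt_forms :: "nat \<Rightarrow> 'a::real_vector form set" where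
  "alt_forms k = {\<omega>.
     (\<forall>vs. length vs \<noteq> k \<longrightarrow> \<omega> vs = 0) \<and>
     (\<forall>vs i. length vs = k \<and> i < k \<longrightarrow> linear (\<lambda>x. \<omega> (vs[i := x]))) \<and>
     (\<forall>vs i j. length vs = k \<and> i < j \<and> j < k \<and> vs ! i = vs ! j \<longrightarrow> \<omega> vs = 0)}"

text \<open>The normalisation of the wedge product is the one with
  \<open>(e\<^sup>1 \<and> \<dots> \<and> e\<^sup>n) [e\<^sub>1, \<dots>, e\<^sub>n] = 1\<close> for dual bases.\<close>

definition wedge :: "nat \<Rightarrow> nat \<Rightarrow> 'a form \<Rightarrow> 'a form \<Rightarrow> 'a form" where
  "wedge k l \<omega> \<eta> vs =
     (if length vs = k + l then
        (\<Sum>p | p permutes {..<k + l}.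
           real_of_int (sign p) * \<omega> (map (\<lambda>i. vs ! p i) [0..<k]) *
           \<eta> (map (\<lambda>i. vs ! p i) [k..<k + l])) / (fact k * fact l)
      else 0)"

definition interior :: "'a \<Rightarrow> 'a form \<Rightarrow> 'a form" where
  "interior v \<omega> = (\<lambda>vs. \<omega> (v # vs))"

text \<open>The Chevalley--Eilenberg differential on forms of degree \<open>k\<close>:
  \<open>(d \<omega>)(x\<^sub>0, \<dots>, x\<^sub>k) = \<Sum> i<j. (-1)\<^sup>i\<^sup>+\<^sup>j \<omega>([x\<^sub>i, x\<^sub>j], x\<^sub>0, \<dots>, x\<^sub>k)\<close>, where \<open>x\<^sub>i\<close> and \<open>x\<^sub>j\<close> are
  omitted from the list after the bracket.\<close>

definition ce_d :: "('a::real_vector \<Rightarrow> 'a \<Rightarrow> 'a) \<Rightarrow> nat \<Rightarrow> 'a form \<Rightarrow> 'a form" where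
  "ce_d br k \<omega> vs =
     (if length vs = Suc k then
        (\<Sum>j<Suc k. \<Sum>i<j. (-1) ^ (i + j) * \<omega> (br (vs ! i) (vs ! j) # nths vs (- {i, j})))
      else 0)"

lemma ce_d_1: "ce_d br 1 \<alpha> [x, y] = - \<alpha> [br x y]"
  by (simp add: ce_d_def nths_def numeral_2_eq_2)

lemma ce_d_2:
  "ce_d br 2 \<omega> [x, y, z] = - \<omega> [br x y, z] + \<omega> [br x z, y] - \<omega> [br y z, x]"
  by (simp add: ce_d_def nths_def eval_nat_numeral upt_rec)

lemma ce_d_3:
  "ce_d br 3 \<phi> [x, y, z, w] =
     - \<phi> [br x y, z, w] + \<phi> [br x z, y, w] - \<phi> [br x w, y, z]
     - \<phi> [br y z, x, w] + \<phi> [br y w, x, z] - \<phi> [br z w, x, y]"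
  by (simp add: ce_d_def nths_def eval_nat_numeral upt_rec)

lemma sum_permutes_2:
  fixes f :: "(nat \<Rightarrow> nat) \<Rightarrow> real"
  shows "(\<Sum>p | p permutes {..<2}. f p) = f id + f (transpose 0 1)"
proof -
  have "{..<2::nat} = insert 0 {1}" by auto
  then show ?thesis
    by (simp add: sum_over_permutations_insert del: One_nat_def)
qed

lemma sum_permutes_3:
  fixes f :: "(nat \<Rightarrow> nat) \<Rightarrow> real"
  shows "(\<Sum>p | p permutes {..<3}. f p) =
    (\<Sum>a\<in>{0,1,2}. \<Sum>b\<in>{1,2}. f (transpose 0 a \<circ> transpose 1 b))"
proof -
  have "{..<3::nat} = insert 0 {1,2}" by auto
  then show ?thesis
    by (simp add: sum_over_permutations_insert del: One_nat_def)
qed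

lemma sum_permutes_4:
  fixes f :: "(nat \<Rightarrow> nat) \<Rightarrow> real"
  shows "(\<Sum>p | p permutes {..<4}. f p) =
    (\<Sum>a\<in>{0,1,2,3}. \<Sum>b\<in>{1,2,3}. \<Sum>c\<in>{2,3}.
       f (transpose 0 a \<circ> (transpose 1 b \<circ> transpose 2 c)))"
proof -
  have "{..<4::nat} = insert 0 {1,2,3}" by auto
  then show ?thesis
    by (simp add: sum_over_permutations_insert del: One_nat_def)
qed

lemmas wedge_expand = sum_permutes_2 sum_permutes_3 sum_permutes_4
  sum_permutes_2[unfolded numeral_2_eq_2] sum_permutes_3[unfolded numeral_3_eq_3]
  sign_compose sign_swap_id permutation_swap_id permutation_compose transpose_def
  upt_rec fact_numeral

lemma wedge_11: "wedge 1 1 \<alpha> \<beta> [x, y] = \<alpha> [x] * \<beta> [y] - \<alpha> [y] * \<beta> [x]"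
  unfolding wedge_def by (simp add: wedge_expand)

lemma wedge_12:
  "wedge 1 2 \<alpha> \<omega> [x, y, z] =
    (\<alpha> [x] * (\<omega> [y, z] - \<omega> [z, y]) + \<alpha> [y] * (\<omega> [z, x] - \<omega> [x, z])
     + \<alpha> [z] * (\<omega> [x, y] - \<omega> [y, x])) / 2"
  unfolding wedge_def by (simp add: wedge_expand field_simps)

lemma wedge_21:
  "wedge 2 1 \<omega> \<alpha> [x, y, z] =
    (\<alpha> [x] * (\<omega> [y, z] - \<omega> [z, y]) + \<alpha> [y] * (\<omega> [z, x] - \<omega> [x, z])
     + \<alpha> [z] * (\<omega> [x, y] - \<omega> [y, x])) / 2"
  unfolding wedge_def by (simp add: wedge_expand field_simps)

lemma wedge_22:
  assumes "\<And>u v. \<omega> [v, u] = - \<omega> [u, v]" "\<And>u v. \<eta> [v, u] = - \<eta> [u, v]"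
  shows "wedge 2 2 \<omega> \<eta> [x, y, z, w] =
     \<omega> [x, y] * \<eta> [z, w] - \<omega> [x, z] * \<eta> [y, w] + \<omega> [x, w] * \<eta> [y, z]
   + \<omega> [y, z] * \<eta> [x, w] - \<omega> [y, w] * \<eta> [x, z] + \<omega> [z, w] * \<eta> [x, y]"
  unfolding wedge_def
  by (simp add: wedge_expand assms(1)[of y x] assms(1)[of z x] assms(1)[of w x]
      assms(1)[of z y] assms(1)[of w y] assms(1)[of w z]
      assms(2)[of y x] assms(2)[of z x] assms(2)[of w x]
      assms(2)[of z y] assms(2)[of w y] assms(2)[of w z])

lemma wedge_13:
  assumes "\<And>u v w. \<phi> [v, u, w] = - \<phi> [u, v, w]" "\<And>u v w. \<phi> [u, w, v] = - \<phi> [u, v, w]"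
  shows "wedge 1 3 \<alpha> \<phi> [x, y, z, w] =
     \<alpha> [x] * \<phi> [y, z, w] - \<alpha> [y] * \<phi> [x, z, w] + \<alpha> [z] * \<phi> [x, y, w] - \<alpha> [w] * \<phi> [x, y, z]"
proof -
  have p: "\<phi> [u, w, v] = - \<phi> [u, v, w]" "\<phi> [v, u, w] = - \<phi> [u, v, w]"
    "\<phi> [v, w, u] = \<phi> [u, v, w]" "\<phi> [w, u, v] = \<phi> [u, v, w]" "\<phi> [w, v, u] = - \<phi> [u, v, w]"
    for u v w
    using assms by (metis minus_minus)+
  show ?thesis
    unfolding wedge_def
    by (simp add: wedge_expand p[where u=x and v=y and w=z] p[where u=x and v=y and w=w]
        p[where u=x and v=z and w=w] p[where u=y and v=z and w=w])
qed

lemma alt_forms_2_swap: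
  assumes "\<omega> \<in> alt_forms 2"
  shows "\<omega> [y, x] = - \<omega> [x, y]"
proof -
  have l: "linear (\<lambda>x. \<omega> (vs[i := x]))" if "length vs = 2" "i < 2" for vs i
    using assms that unfolding alt_forms_def by blast
  have z: "\<omega> [u, u] = 0" for u
  proof -
    have "length [u, u] = 2 \<and> (0::nat) < 1 \<and> (1::nat) < 2 \<and> [u, u] ! 0 = [u, u] ! 1"
      by simp
    then show ?thesis
      using assms unfolding alt_forms_def by blast
  qed
  have a: "\<omega> [u + v, w] = \<omega> [u, w] + \<omega> [v, w]" for u v w
    using linear_add[OF l[of "[u, w]" 0], of u v] by simp
  have b: "\<omega> [w, u + v] = \<omega> [w, u] + \<omega> [w, v]" for u v w
    using linear_add[OF l[of "[w, u]" 1], of u v] by simp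
  show ?thesis
    using z[of x] z[of y] z[of "x + y"] unfolding a b by linarith
qed

lemma alt_forms_1_neg:
  assumes "\<alpha> \<in> alt_forms 1"
  shows "\<alpha> [- u] = - \<alpha> [u]"
proof -
  have "length [u] = 1 \<and> (0::nat) < 1" by simp
  then have "linear (\<lambda>x. \<alpha> ([u][0 := x]))"
    using assms unfolding alt_forms_def by blast
  from linear_neg[OF this, of u] show ?thesis by simp
qed

lemma alt_forms_2_neg:
  assumes "\<omega> \<in> alt_forms 2"
  shows "\<omega> [- u, v] = - \<omega> [u, v]"
proof -
  have "length [u, v] = 2 \<and> (0::nat) < 2" by simp
  then have "linear (\<lambda>x. \<omega> ([u, v][0 := x]))"
    using assms unfolding alt_forms_def by blast
  from linear_neg[OF this, of u] show ?thesis by simp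
qed

lemma (in lie_algebra) br_swap: "br u v = - br v u"
proof -
  have "br (u + v) (u + v) = br u v + br v u"
    by (simp only: linear_add[OF linear_left] linear_add[OF linear_right]) (simp add: self)
  then show ?thesis
    unfolding self by (metis eq_neg_iff_add_eq_0)
qed

text \<open>\<open>ce_d\<close> is the graded derivation extending \<open>d \<alpha> (x, y) = - \<alpha> [x, y]\<close>; in the
  degrees that determine it (by linearity) on forms of degree \<open>3\<close> this is \<open>ce_d_1\<close> together with
  the following two lemmas.\<close>

lemma ce_d_wedge_11:
  assumes "lie_algebra br" "\<alpha> \<in> alt_forms 1" "\<beta> \<in> alt_forms 1"
  shows "ce_d br 2 (wedge 1 1 \<alpha> \<beta>) [x, y, z] =
    wedge 2 1 (ce_d br 1 \<alpha>) \<beta> [x, y, z] - wedge 1 2 \<alpha> (ce_d br 1 \<beta>) [x, y, z]"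
proof -
  interpret lie_algebra br by fact
  have s: "\<alpha> [br u v] = - \<alpha> [br v u]" "\<beta> [br u v] = - \<beta> [br v u]" for u v
    using br_swap[of u v] alt_forms_1_neg assms by metis+
  show ?thesis
    unfolding wedge_11 wedge_12 wedge_21 ce_d_1 ce_d_2 s[of y x] s[of z x] s[of z y]
    by (simp add: field_simps)
qed

lemma ce_d_wedge_12:
  assumes "lie_algebra br" "\<alpha> \<in> alt_forms 1" "\<omega> \<in> alt_forms 2"
  shows "ce_d br 3 (wedge 1 2 \<alpha> \<omega>) [x, y, z, w] =
    wedge 2 2 (ce_d br 1 \<alpha>) \<omega> [x, y, z, w] - wedge 1 3 \<alpha> (ce_d br 2 \<omega>) [x, y, z, w]"
proof -
  interpret lie_algebra br by fact
  have s: "\<alpha> [br u v] = - \<alpha> [br v u]" for u v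
    using br_swap[of u v] alt_forms_1_neg assms by metis
  have t: "\<omega> [br u v, q] = - \<omega> [br v u, q]" for u v q
    using br_swap[of u v] alt_forms_2_neg assms by metis
  note sw = alt_forms_2_swap[OF assms(3)]
  have 22: "wedge 2 2 (ce_d br 1 \<alpha>) \<omega> [x, y, z, w] =
      - \<alpha> [br x y] * \<omega> [z, w] + \<alpha> [br x z] * \<omega> [y, w] - \<alpha> [br x w] * \<omega> [y, z]
    - \<alpha> [br y z] * \<omega> [x, w] + \<alpha> [br y w] * \<omega> [x, z] - \<alpha> [br z w] * \<omega> [x, y]"
    by (subst wedge_22) (simp_all only: ce_d_1, simp_all add: s[symmetric] sw[symmetric])
  have 13: "wedge 1 3 \<alpha> (ce_d br 2 \<omega>) [x, y, z, w] =
      \<alpha> [x] * ce_d br 2 \<omega> [y, z, w] - \<alpha> [y] * ce_d br 2 \<omega> [x, z, w]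
    + \<alpha> [z] * ce_d br 2 \<omega> [x, y, w] - \<alpha> [w] * ce_d br 2 \<omega> [x, y, z]"
  proof (rule wedge_13)
    show "ce_d br 2 \<omega> [v, u, q] = - ce_d br 2 \<omega> [u, v, q]" for u v q
      unfolding ce_d_2 using t[of u v q] by simp
    show "ce_d br 2 \<omega> [u, q, v] = - ce_d br 2 \<omega> [u, v, q]" for u v q
      unfolding ce_d_2 using t[of q v u] by simp
  qed
  have 12: "wedge 1 2 \<alpha> \<omega> [a, b, c] = \<alpha> [a] * \<omega> [b, c] - \<alpha> [b] * \<omega> [a, c] + \<alpha> [c] * \<omega> [a, b]"
    for a b c
    unfolding wedge_12 using sw[of b c] sw[of a c] sw[of a b] by (simp add: field_simps)
  show ?thesis
    unfolding 22 13 12 ce_d_2 ce_d_3 by (simp add: field_simps)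
qed

section \<open>G2-structures on seven-dimensional Lie algebras\<close>

definition b_form :: "'a::real_vector form \<Rightarrow> 'a \<Rightarrow> 'a \<Rightarrow> 'a form" where
  "b_form \<phi> v w = (\<lambda>vs. 1 / 6 * wedge 4 3 (wedge 2 2 (interior v \<phi>) (interior w \<phi>)) \<phi> vs)"

text \<open>\<open>det_root \<phi>\<close> is the form \<open>det(b\<^sub>\<phi>)\<^sup>1\<^sup>/\<^sup>9\<close> of degree \<open>7\<close>. On a basis \<open>vs\<close> one has
  \<open>b\<^sub>\<phi>(e\<^sub>i, e\<^sub>j) = B\<^sub>i\<^sub>j e\<^sup>1 \<and> \<dots> \<and> e\<^sup>7\<close> with \<open>B\<^sub>i\<^sub>j = b\<^sub>\<phi>(e\<^sub>i, e\<^sub>j)(e\<^sub>1, \<dots>, e\<^sub>7)\<close>; if \<open>vs\<close> is linearly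
  dependent then \<open>B = 0\<close> and the value is \<open>0\<close>, as it must be. Note that \<open>root 9\<close> is odd, so it
  is the real ninth root of negative numbers as well.\<close>

definition det_root :: "'a::real_vector form \<Rightarrow> 'a form" where
  "det_root \<phi> vs =
     (if length vs = 7
      then root 9 (Determinant.det (mat 7 7 (\<lambda>(i, j). b_form \<phi> (vs ! i) (vs ! j) vs)))
      else 0)"

definition stable_form :: "'a::real_vector form \<Rightarrow> bool" where
  "stable_form \<phi> \<longleftrightarrow> \<phi> \<in> alt_forms 3 \<and> det_root \<phi> \<noteq> (\<lambda>vs. 0)"

text \<open>\<open>b\<^sub>\<phi>(v, w)\<close> and the nonzero \<open>det(b\<^sub>\<phi>)\<^sup>1\<^sup>/\<^sup>9\<close> lie in the line of forms of degree \<open>7\<close>, and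
  \<open>g_form \<phi> v w\<close> is their quotient.\<close>

definition g_form :: "'a::real_vector form \<Rightarrow> 'a \<Rightarrow> 'a \<Rightarrow> real" where
  "g_form \<phi> v w = (THE c. b_form \<phi> v w = (\<lambda>vs. c * det_root \<phi> vs))"

definition G2_structure :: "'a::real_vector form \<Rightarrow> bool" where
  "G2_structure \<phi> \<longleftrightarrow>
     dim (UNIV :: 'a set) = 7 \<and> stable_form \<phi> \<and> (\<forall>v. v \<noteq> 0 \<longrightarrow> g_form \<phi> v v > 0)"

definition closed_form :: "('a::real_vector \<Rightarrow> 'a \<Rightarrow> 'a) \<Rightarrow> nat \<Rightarrow> 'a form \<Rightarrow> bool" where
  "closed_form br k \<omega> \<longleftrightarrow> ce_d br k \<omega> = (\<lambda>vs. 0)"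

end

theory Submission
  imports Defs
begin

text \<open>Suppose that \<open>\<phi>\<close> is a closed \<open>G\<^sub>2\<close>-structure and let \<open>z \<noteq> 0\<close> be in the center of \<open>R\<close>. As \<open>R\<close>
  commutes with \<open>S\<close>, the vector \<open>z\<close> is central in the whole Lie algebra, hence the 2-form
  \<open>\<omega> = \<phi> [z, _, _]\<close> is closed. For \<open>x, y \<in> S\<close> and \<open>r \<in> R\<close>, all brackets between \<open>x, y, r\<close> other than
  that of \<open>x\<close> and \<open>y\<close> vanish, so closedness says that \<open>\<omega>\<close> pairs \<open>br x y\<close> and \<open>r\<close> to zero
  (\<open>closed_form_central_contraction\<close>). A three-dimensional semisimple Lie algebra is spanned by its
  brackets (\<open>semisimple_dim_3_perfect\<close>), thus \<open>\<omega>\<close> pairs \<open>S\<close> and \<open>R\<close> to zero. On \<open>S\<close>, whose dimension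
  is odd, the skew form \<open>\<omega>\<close> has a kernel vector \<open>s \<noteq> 0\<close> (\<open>skew_form_dim_3_kernel\<close>), and \<open>s\<close> is then
  in the kernel of \<open>\<omega>\<close> on the whole space.

  But the kernel of \<open>\<phi> [z, _, _]\<close> for a \<open>G\<^sub>2\<close>-structure consists of the multiples of \<open>z\<close> only
  (\<open>G2_structure_nondegenerate\<close>): if \<open>s\<close> is a further kernel vector, then \<open>\<omega> \<and> \<omega>\<close> is annihilated by
  contraction with \<open>s\<close> and with \<open>z\<close>, and \<open>\<phi>\<close> by contraction with both. So \<open>\<omega> \<and> \<omega> \<and> \<phi>\<close>, whose degree
  is the dimension of the space, vanishes on every basis that contains \<open>s\<close> and \<open>z\<close>, and is therefore
  zero. This is \<open>6 b\<^sub>\<phi>(z, z)\<close>, in contradiction with \<open>g\<^sub>\<phi>(z, z) > 0\<close>.\<close>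

section \<open>Alternating forms\<close>

lemma alt_forms_wrong_length: "\<omega> \<in> alt_forms k \<Longrightarrow> length vs \<noteq> k \<Longrightarrow> \<omega> vs = 0"
  unfolding alt_forms_def by blast

lemma alt_forms_linear:
  "\<omega> \<in> alt_forms k \<Longrightarrow> length vs = k \<Longrightarrow> i < k \<Longrightarrow> linear (\<lambda>x. \<omega> (vs[i := x]))"
  unfolding alt_forms_def by blast

lemma alt_forms_repeated:
  assumes "\<omega> \<in> alt_forms k" "length vs = k" "i < k" "j < k" "i \<noteq> j" "vs ! i = vs ! j"
  shows "\<omega> vs = 0"
proof -
  have "\<omega> vs = 0" if "a < b" "b < k" "vs ! a = vs ! b" for a b
    using assms(1,2) that unfolding alt_forms_def by blast
  from this[of i j] this[of j i] show ?thesis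
    using assms by (cases i j rule: linorder_cases) auto
qed

lemma alt_forms_swap:
  assumes "\<omega> \<in> alt_forms k" "length vs = k" "i < k" "j < k" "i \<noteq> j"
  shows "\<omega> (vs[i := y, j := x]) = - \<omega> (vs[i := x, j := y])"
proof -
  have z: "\<omega> (vs[i := u, j := u]) = 0" for u
    by (rule alt_forms_repeated[OF assms(1), of _ i j]) (use assms in auto)
  have a: "\<omega> (vs[i := u + v, j := w]) = \<omega> (vs[i := u, j := w]) + \<omega> (vs[i := v, j := w])" for u v w
    using linear_add[OF alt_forms_linear[OF assms(1), of "vs[j := w]" i], of u v] assms
    by (simp add: list_update_swap)
  have b: "\<omega> (vs[i := w, j := u + v]) = \<omega> (vs[i := w, j := u]) + \<omega> (vs[i := w, j := v])" for u v w
    using linear_add[OF alt_forms_linear[OF assms(1), of "vs[i := w]" j], of u v] assms by simp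
  show ?thesis
    using z[of "x + y"] z[of x] z[of y] unfolding a b by simp
qed

lemma interior_alt_forms:
  assumes "\<omega> \<in> alt_forms (Suc k)"
  shows "interior v \<omega> \<in> alt_forms k"
  unfolding alt_forms_def interior_def
proof (intro CollectI conjI allI impI)
  fix vs :: "'a list" assume "length vs \<noteq> k"
  then show "\<omega> (v # vs) = 0" using alt_forms_wrong_length[OF assms] by simp
next
  fix vs :: "'a list" and i assume "length vs = k \<and> i < k"
  then show "linear (\<lambda>x. \<omega> (v # vs[i := x]))"
    using alt_forms_linear[OF assms, of "v # vs" "Suc i"] by simp
next
  fix vs :: "'a list" and i j assume "length vs = k \<and> i < j \<and> j < k \<and> vs ! i = vs ! j"
  then show "\<omega> (v # vs) = 0"
    using alt_forms_repeated[OF assms, of "v # vs" "Suc i" "Suc j"] by simp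
qed

lemma wedge_alt_forms:
  fixes \<omega> \<eta> :: "'a::real_vector form"
  assumes \<omega>: "\<omega> \<in> alt_forms k" and \<eta>: "\<eta> \<in> alt_forms l"
  shows "wedge k l \<omega> \<eta> \<in> alt_forms (k + l)"
  unfolding alt_forms_def
proof (intro CollectI conjI allI impI)
  fix vs :: "'a list" assume "length vs \<noteq> k + l"
  then show "wedge k l \<omega> \<eta> vs = 0" by (simp add: wedge_def)
next
  fix vs :: "'a list" and i assume i: "length vs = k + l \<and> i < k + l"
  have "linear (\<lambda>x. real_of_int (sign p) * \<omega> (map (\<lambda>n. vs[i := x] ! p n) [0..<k]) *
      \<eta> (map (\<lambda>n. vs[i := x] ! p n) [k..<k + l]))" if p: "p permutes {..<k + l}" for p
  proof -
    define a where "a = Hilbert_Choice.inv p i"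
    have pa: "p n = i \<longleftrightarrow> n = a" for n
      using permutes_inverses[OF p] by (auto simp: a_def)
    have "a < k + l"
      using permutes_in_image[OF permutes_inv[OF p], of i] i by (simp add: a_def)
    have nth: "vs[i := x] ! p n = (if n = a then x else vs ! p n)" for n x
      using i pa[of n] by (cases "n = a") auto
    show ?thesis
    proof (cases "a < k")
      case True
      have 1: "map (\<lambda>n. vs[i := x] ! p n) [0..<k] = (map (\<lambda>n. vs ! p n) [0..<k])[a := x]" for x
        by (rule nth_equalityI) (auto simp: nth nth_list_update)
      have 2: "map (\<lambda>n. vs[i := x] ! p n) [k..<k + l] = map (\<lambda>n. vs ! p n) [k..<k + l]" for x
        using True by (auto simp: nth)
      have "linear (\<lambda>x. (real_of_int (sign p) * \<eta> (map (\<lambda>n. vs ! p n) [k..<k + l]))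
          *\<^sub>R \<omega> ((map (\<lambda>n. vs ! p n) [0..<k])[a := x]))"
        by (rule linear_compose_scale_right[OF alt_forms_linear[OF \<omega>]]) (simp_all add: True)
      then show ?thesis unfolding 1 2 by (simp add: ac_simps)
    next
      case False
      have 1: "map (\<lambda>n. vs[i := x] ! p n) [k..<k + l] =
          (map (\<lambda>n. vs ! p n) [k..<k + l])[a - k := x]" for x
        using False by (intro nth_equalityI) (auto simp: nth nth_list_update)
      have 2: "map (\<lambda>n. vs[i := x] ! p n) [0..<k] = map (\<lambda>n. vs ! p n) [0..<k]" for x
        using False by (auto simp: nth)
      have "linear (\<lambda>x. (real_of_int (sign p) * \<omega> (map (\<lambda>n. vs ! p n) [0..<k]))
          *\<^sub>R \<eta> ((map (\<lambda>n. vs ! p n) [k..<k + l])[a - k := x]))"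
        by (rule linear_compose_scale_right[OF alt_forms_linear[OF \<eta>]])
          (use False \<open>a < k + l\<close> in auto)
      then show ?thesis unfolding 1 2 by (simp add: ac_simps)
    qed
  qed
  then have "linear (\<lambda>x. (1 / (fact k * fact l)) *\<^sub>R (\<Sum>p | p permutes {..<k + l}.
      real_of_int (sign p) * \<omega> (map (\<lambda>n. vs[i := x] ! p n) [0..<k]) *
      \<eta> (map (\<lambda>n. vs[i := x] ! p n) [k..<k + l])))"
    by (intro linear_compose_scale_right[OF linear_compose_sum] ballI) simp
  then show "linear (\<lambda>x. wedge k l \<omega> \<eta> (vs[i := x]))"
    using i by (simp add: wedge_def)
next
  fix vs :: "'a list" and i j
  assume ij: "length vs = k + l \<and> i < j \<and> j < k + l \<and> vs ! i = vs ! j"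
  let ?t = "transpose i j"
  let ?f = "\<lambda>p. real_of_int (sign p) * \<omega> (map (\<lambda>n. vs ! p n) [0..<k]) *
      \<eta> (map (\<lambda>n. vs ! p n) [k..<k + l])"
  have t: "?t permutes {..<k + l}"
    using ij by (intro permutes_swap_id) auto
  have vs: "vs ! ?t n = vs ! n" for n
    using ij by (auto simp: transpose_def)
  \<comment> \<open>Composing with the transposition preserves the arguments and reverses the sign, so the sum
    equals its own negative.\<close>
  have "sum ?f {p. p permutes {..<k + l}} = (\<Sum>p | p permutes {..<k + l}. ?f (?t \<circ> p))"
    by (rule setum_permutations_compose_left[OF t])
  also have "\<dots> = (\<Sum>p | p permutes {..<k + l}. - ?f p)"
  proof (rule sum.cong[OF refl])
    fix p assume "p \<in> {p. p permutes {..<k + l}}"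
    then have "permutation p" by (auto simp: permutation_permutes)
    then have "sign (?t \<circ> p) = - sign p"
      using ij by (simp add: sign_compose permutation_swap_id sign_swap_id)
    then show "?f (?t \<circ> p) = - ?f p" by (simp add: vs)
  qed
  also have "\<dots> = - sum ?f {p. p permutes {..<k + l}}" by (simp add: sum_negf)
  finally show "wedge k l \<omega> \<eta> vs = 0"
    by (simp add: wedge_def)
qed

text \<open>In every summand of the wedge product, the vectors of \<open>K\<close> are distributed over the arguments
  of the two factors: either the first factor gets one of them, or the second gets them all.\<close>

lemma wedge_annihilated:
  assumes \<omega>: "\<And>us. K \<inter> set us \<noteq> {} \<Longrightarrow> \<omega> us = 0" and \<eta>: "\<And>us. K \<subseteq> set us \<Longrightarrow> \<eta> us = 0"
    and K: "K \<subseteq> set vs"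
  shows "wedge k l \<omega> \<eta> vs = 0"
proof (cases "length vs = k + l")
  case True
  have "\<omega> (map (\<lambda>n. vs ! p n) [0..<k]) * \<eta> (map (\<lambda>n. vs ! p n) [k..<k + l]) = 0"
    if p: "p permutes {..<k + l}" for p
  proof (cases "K \<inter> set (map (\<lambda>n. vs ! p n) [0..<k]) = {}")
    case disjoint: True
    have "K \<subseteq> set (map (\<lambda>n. vs ! p n) [k..<k + l])"
    proof
      fix v assume "v \<in> K"
      then obtain m where m: "m < k + l" "v = vs ! m"
        using K True by (metis in_set_conv_nth subsetD)
      then obtain n where n: "n < k + l" "m = p n"
        using permutes_image[OF p] by (metis imageE lessThan_iff)
      then have "\<not> n < k" using disjoint \<open>v \<in> K\<close> m by auto
      then show "v \<in> set (map (\<lambda>n. vs ! p n) [k..<k + l])" using m n by simp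
    qed
    then show ?thesis using \<eta> by simp
  qed (use \<omega> in simp)
  then have "(\<Sum>p | p permutes {..<k + l}. real_of_int (sign p) *
      \<omega> (map (\<lambda>n. vs ! p n) [0..<k]) * \<eta> (map (\<lambda>n. vs ! p n) [k..<k + l])) = 0"
    by (intro sum.neutral) auto
  then show ?thesis by (simp add: wedge_def)
qed (simp add: wedge_def)

section \<open>Alternating forms of top degree\<close>

lemma alt_forms_zero_on_span:
  assumes "\<omega> \<in> alt_forms k" "length vs = k" "i < k"
    and "x \<in> span {vs ! j | j. j < k \<and> j \<noteq> i}"
  shows "\<omega> (vs[i := x]) = 0"
proof (rule linear_eq_0_on_span[OF alt_forms_linear[OF assms(1-3)] _ assms(4)])
  fix y assume "y \<in> {vs ! j | j. j < k \<and> j \<noteq> i}"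
  then obtain j where "j < k" "j \<noteq> i" "y = vs ! j" by blast
  then show "\<omega> (vs[i := y]) = 0"
    using assms(2,3) by (intro alt_forms_repeated[OF assms(1), of _ i j]) auto
qed

lemma alt_forms_nonzero_distinct:
  assumes "\<omega> \<in> alt_forms k" "\<omega> vs \<noteq> 0"
  shows "length vs = k" "distinct vs"
proof -
  show l: "length vs = k" using alt_forms_wrong_length assms by blast
  show "distinct vs"
    unfolding distinct_conv_nth using alt_forms_repeated[OF assms(1) l] assms(2) l by metis
qed

lemma alt_forms_nonzero_independent:
  assumes "\<omega> \<in> alt_forms k" "\<omega> vs \<noteq> 0"
  shows "independent (set vs)"
proof
  note l = alt_forms_nonzero_distinct[OF assms]
  assume "dependent (set vs)"
  then obtain v where "v \<in> set vs" "v \<in> span (set vs - {v})"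
    unfolding dependent_def by blast
  then obtain i where i: "i < k" "v = vs ! i"
    using l by (metis in_set_conv_nth)
  have "set vs - {v} \<subseteq> {vs ! j | j. j < k \<and> j \<noteq> i}"
    using l i by (auto simp: in_set_conv_nth)
  then have "v \<in> span {vs ! j | j. j < k \<and> j \<noteq> i}"
    using \<open>v \<in> span (set vs - {v})\<close> span_mono by blast
  from alt_forms_zero_on_span[OF assms(1) l(1) i(1) this] show False
    using assms(2) i by simp
qed

text \<open>The positivity of the dimension ensures that the space has a finite basis, as \<open>dim\<close> is \<open>0\<close>
  otherwise.\<close>

lemma independent_card_eq_dim_spans:
  fixes V B :: "'a::real_vector set"
  assumes "independent B" "B \<subseteq> V" "card B = dim V" "dim V > 0"
  shows "V \<subseteq> span B"
proof
  fix x assume "x \<in> V"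
  obtain C where C: "C \<subseteq> V" "independent C" "V \<subseteq> span C" "card C = dim V"
    by (rule real_vector.basis_exists)
  have "finite C"
    by (rule card_ge_0_finite) (use C(4) assms(4) in linarith)
  have "finite B"
    by (rule card_ge_0_finite) (use assms(3,4) in linarith)
  show "x \<in> span B"
  proof (rule ccontr)
    assume x: "x \<notin> span B"
    then have "independent (insert x B)"
      using assms(1) real_vector.span_base by (auto simp: real_vector.independent_insert)
    moreover have "insert x B \<subseteq> span C" using assms(2) \<open>x \<in> V\<close> C(3) by blast
    ultimately have "card (insert x B) \<le> card C"
      using real_vector.independent_span_bound[OF \<open>finite C\<close>] by blast
    moreover have "x \<notin> B" using x real_vector.span_base by blast
    ultimately show False using \<open>finite B\<close> C(4) assms(3) by simp
  qed
qed

text \<open>Replacing the \<open>i\<close>-th vector of a basis by \<open>x\<close> multiplies the value by the \<open>i\<close>-th coordinate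
  of \<open>x\<close>, and \<open>x\<close> has a nonzero coordinate outside \<open>A\<close>.\<close>

lemma alt_forms_exchange:
  fixes \<omega> :: "'a::real_vector form"
  assumes \<omega>: "\<omega> \<in> alt_forms k" "\<omega> vs \<noteq> 0" and dim: "dim (UNIV :: 'a set) = k" "k > 0"
    and x: "x \<notin> span {vs ! j | j. j < k \<and> j \<in> A}"
  obtains i where "i < k" "i \<notin> A" "\<omega> (vs[i := x]) \<noteq> 0"
proof -
  note l = alt_forms_nonzero_distinct[OF \<omega>]
  note ind = alt_forms_nonzero_independent[OF \<omega>]
  have span: "y \<in> span (set vs)" for y
    using independent_card_eq_dim_spans[OF ind, of UNIV] l dim by (auto simp: distinct_card)
  let ?r = "representation (set vs)"
  have coord: "\<omega> (vs[i := y]) = \<omega> vs *\<^sub>R ?r y (vs ! i)" if i: "i < k" for i y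
  proof (rule real_vector.linear_eq_on_span[OF alt_forms_linear[OF \<omega>(1) l(1) i] _ _ span])
    show "linear (\<lambda>y. \<omega> vs *\<^sub>R ?r y (vs ! i))"
      using real_vector.representation_add[OF ind span span]
        real_vector.representation_scale[OF ind span]
      by (intro linearI) (simp_all add: algebra_simps)
    fix b assume "b \<in> set vs"
    then obtain j where j: "j < k" "b = vs ! j" using l by (metis in_set_conv_nth)
    show "\<omega> (vs[i := b]) = \<omega> vs *\<^sub>R ?r b (vs ! i)"
    proof (cases "j = i")
      case True
      then show ?thesis
        using real_vector.representation_basis[OF ind \<open>b \<in> set vs\<close>] j by simp
    next
      case False
      then have "\<omega> (vs[i := b]) = 0"
        using i j l by (intro alt_forms_repeated[OF \<omega>(1), of _ i j]) auto
      moreover have "b \<noteq> vs ! i" using False i j l by (simp add: nth_eq_iff_index_eq)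
      ultimately show ?thesis
        using real_vector.representation_basis[OF ind \<open>b \<in> set vs\<close>] by simp
    qed
  qed
  have "\<exists>i<k. i \<notin> A \<and> \<omega> (vs[i := x]) \<noteq> 0"
  proof (rule ccontr)
    assume no: "\<not> ?thesis"
    have "b \<in> span {vs ! j | j. j < k \<and> j \<in> A}" if b: "?r x b \<noteq> 0" for b
    proof -
      obtain j where j: "j < k" "b = vs ! j"
        using real_vector.representation_ne_zero[OF b] l by (metis in_set_conv_nth)
      then have "j \<in> A" using no coord[of j x] b \<omega>(2) by auto
      then show ?thesis using j by (intro real_vector.span_base) blast
    qed
    then have "(\<Sum>b | ?r x b \<noteq> 0. ?r x b *\<^sub>R b) \<in> span {vs ! j | j. j < k \<and> j \<in> A}"
      by (intro real_vector.span_sum real_vector.span_scale) auto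
    then show False
      using x real_vector.sum_nonzero_representation_eq[OF ind span] by simp
  qed
  then show thesis using that by blast
qed

text \<open>A nonzero form of top degree is nonzero on every basis: from a list on which it does not
  vanish, two exchanges lead to one that contains \<open>s\<close> and \<open>z\<close>.\<close>

lemma top_form_eq_0:
  fixes \<omega> :: "'a::real_vector form"
  assumes \<omega>: "\<omega> \<in> alt_forms k" and dim: "dim (UNIV :: 'a set) = k" "k > 0"
    and "s \<noteq> 0" and z: "z \<notin> span {s}"
    and vanish: "\<And>us. s \<in> set us \<Longrightarrow> z \<in> set us \<Longrightarrow> \<omega> us = 0"
  shows "\<omega> vs = 0"
proof (rule ccontr)
  assume nz: "\<omega> vs \<noteq> 0"
  have "{vs ! j | j. j < k \<and> j \<in> {}} = {}" by blast
  then have "s \<notin> span {vs ! j | j. j < k \<and> j \<in> {}}"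
    using \<open>s \<noteq> 0\<close> by (simp only: real_vector.span_empty singleton_iff not_False_eq_True)
  from alt_forms_exchange[OF \<omega> nz dim this]
  obtain i where i: "i < k" "\<omega> (vs[i := s]) \<noteq> 0" .
  have l: "length vs = k" by (rule alt_forms_nonzero_distinct[OF \<omega> nz])
  have "{vs[i := s] ! j | j. j < k \<and> j \<in> {i}} = {s}" using i l by auto
  then have "z \<notin> span {vs[i := s] ! j | j. j < k \<and> j \<in> {i}}" using z by simp
  from alt_forms_exchange[OF \<omega> i(2) dim this]
  obtain j where j: "j < k" "j \<notin> {i}" "\<omega> (vs[i := s, j := z]) \<noteq> 0" .
  have "vs[i := s, j := z] ! i = s" "vs[i := s, j := z] ! j = z" using i j l by auto
  then have "s \<in> set (vs[i := s, j := z])" "z \<in> set (vs[i := s, j := z])"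
    using i j l by (metis length_list_update nth_mem)+
  then show False using vanish j(3) by blast
qed

section \<open>Degenerate contractions\<close>

lemma alt_forms_3_kernel:
  assumes \<phi>: "\<phi> \<in> alt_forms 3" and ker: "\<And>w. \<phi> [z, s, w] = 0"
    and "s \<noteq> z" "{s, z} \<subseteq> set us"
  shows "\<phi> us = 0"
proof (cases "length us = 3")
  case True
  then have "us = [us ! 0, us ! 1, us ! 2]"
    by (intro nth_equalityI) (auto simp: less_Suc_eq numeral_3_eq_3 numeral_2_eq_2)
  then obtain a b c where us: "us = [a, b, c]" by blast
  have s1: "\<phi> [v, u, w] = - \<phi> [u, v, w]" for u v w
    using alt_forms_swap[OF \<phi>, of "[u, v, w]" 0 1 v u] by simp
  have s2: "\<phi> [u, w, v] = - \<phi> [u, v, w]" for u v w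
    using alt_forms_swap[OF \<phi>, of "[u, v, w]" 1 2 w v] by (simp add: numeral_2_eq_2)
  have "\<phi> [s, z, w] = 0" "\<phi> [z, w, s] = 0" "\<phi> [s, w, z] = 0" "\<phi> [w, z, s] = 0" "\<phi> [w, s, z] = 0" for w
    using ker[of w] s1[of z s w] s2[of z s w] s2[of s z w] s1[of z w s] s1[of s w z] by auto
  then show ?thesis using assms(3,4) us ker by auto
qed (use alt_forms_wrong_length[OF \<phi>] in blast)

text \<open>A kernel vector of \<open>interior z \<phi>\<close> that is independent of \<open>z\<close> makes \<open>z\<close> isotropic. Among seven
  arguments containing \<open>s\<close> and \<open>z\<close>, one of the two goes to the square of \<open>interior z \<phi>\<close>, which has
  both of them in its kernel, or both go to \<open>\<phi>\<close>.\<close>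

lemma b_form_degenerate:
  fixes \<phi> :: "'a::real_vector form"
  assumes \<phi>: "\<phi> \<in> alt_forms 3" and dim: "dim (UNIV :: 'a set) = 7"
    and "s \<noteq> 0" and z: "z \<notin> span {s}" and ker: "\<And>w. \<phi> [z, s, w] = 0"
  shows "b_form \<phi> z z = (\<lambda>vs. 0)"
proof -
  let ?\<omega> = "interior z \<phi>"
  let ?\<eta> = "wedge 2 2 ?\<omega> ?\<omega>"
  have "s \<noteq> z" using z real_vector.span_base by blast
  have \<omega>: "?\<omega> \<in> alt_forms 2"
    using interior_alt_forms[of \<phi> 2 z] \<phi> by simp
  have "?\<eta> \<in> alt_forms 4"
    using wedge_alt_forms[OF \<omega> \<omega>] by simp
  then have top: "wedge 4 3 ?\<eta> \<phi> \<in> alt_forms 7"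
    using wedge_alt_forms[OF _ \<phi>, of _ 4] by simp
  have \<omega>0: "?\<omega> us = 0" if "{v} \<inter> set us \<noteq> {}" "v = s \<or> v = z" for v us
  proof -
    have "\<phi> (z # us) = 0" if "s \<in> set us"
      using that by (intro alt_forms_3_kernel[OF \<phi> ker \<open>s \<noteq> z\<close>]) auto
    moreover have "\<phi> (z # us) = 0" if "z \<in> set us"
      using that alt_forms_nonzero_distinct(2)[OF \<phi>, of "z # us"] by auto
    ultimately show ?thesis using that by (auto simp: interior_def)
  qed
  have \<eta>0: "?\<eta> us = 0" if "v \<in> set us" "v = s \<or> v = z" for v us
    by (rule wedge_annihilated[of "{v}"]) (use \<omega>0 that in auto)
  have vanish: "wedge 4 3 ?\<eta> \<phi> us = 0" if "s \<in> set us" "z \<in> set us" for us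
  proof (rule wedge_annihilated[of "{s, z}"])
    show "?\<eta> vs = 0" if "{s, z} \<inter> set vs \<noteq> {}" for vs using that \<eta>0 by auto
    show "\<phi> vs = 0" if "{s, z} \<subseteq> set vs" for vs
      by (rule alt_forms_3_kernel[OF \<phi> ker \<open>s \<noteq> z\<close> that])
  qed (use that in simp)
  have "wedge 4 3 ?\<eta> \<phi> vs = 0" for vs
    by (rule top_form_eq_0[OF top dim _ \<open>s \<noteq> 0\<close> z vanish]) simp_all
  then show ?thesis by (simp add: b_form_def)
qed

lemma G2_structure_nondegenerate:
  fixes \<phi> :: "'a::real_vector form"
  assumes G2: "G2_structure \<phi>" and "s \<noteq> 0" and z: "z \<notin> span {s}"
  shows "\<exists>w. \<phi> [z, s, w] \<noteq> 0"
proof (rule ccontr)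
  assume "\<not> ?thesis"
  then have b: "b_form \<phi> z z = (\<lambda>vs. 0)"
    using G2 assms(2) z by (intro b_form_degenerate) (auto simp: G2_structure_def stable_form_def)
  obtain vs where "det_root \<phi> vs \<noteq> 0"
    using G2 unfolding G2_structure_def stable_form_def by blast
  then have "c = 0" if "b_form \<phi> z z = (\<lambda>vs. c * det_root \<phi> vs)" for c
    using fun_cong[OF that, of vs] b by simp
  then have "g_form \<phi> z z = 0"
    unfolding g_form_def by (intro the_equality) (simp_all add: b)
  moreover have "z \<noteq> 0" using z real_vector.span_zero by blast
  then have "g_form \<phi> z z > 0" using G2 unfolding G2_structure_def by blast
  ultimately show False by simp
qed

text \<open>A skew-symmetric matrix of odd size is singular. In dimension three, the three entries above the
  diagonal, with alternating signs, are the coordinates of a kernel vector, which is nonzero unless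
  the whole matrix is zero.\<close>

lemma skew_form_dim_3_kernel:
  fixes \<omega> :: "'a::real_vector \<Rightarrow> 'a \<Rightarrow> real"
  assumes left: "\<And>y. linear (\<lambda>x. \<omega> x y)" and right: "\<And>x. linear (\<omega> x)"
    and skew: "\<And>x. \<omega> x x = 0"
    and S: "subspace S" "dim S = 3"
  obtains s where "s \<in> S" "s \<noteq> 0" "\<And>y. y \<in> S \<Longrightarrow> \<omega> s y = 0"
proof -
  obtain B where B: "B \<subseteq> S" "independent B" "S \<subseteq> span B" "card B = 3"
    using real_vector.basis_exists S(2) by metis
  then obtain a b c where abc: "B = {a, b, c}" "a \<noteq> b" "a \<noteq> c" "b \<noteq> c"
    by (auto simp: card_3_iff)
  have anti: "\<omega> y x = - \<omega> x y" for x y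
    using skew[of "x + y"] skew[of x] skew[of y]
    by (simp add: linear_add[OF left] linear_add[OF right])
  define s where "s = \<omega> b c *\<^sub>R a - \<omega> a c *\<^sub>R b + \<omega> a b *\<^sub>R c"
  have lin: "\<omega> s y = \<omega> b c * \<omega> a y - \<omega> a c * \<omega> b y + \<omega> a b * \<omega> c y" for y
    unfolding s_def
    by (simp add: linear_add[OF left] linear_diff[OF left] linear_scale[OF left])
  have "\<omega> s y = 0" if "y \<in> B" for y
    using that abc skew anti[of b a] anti[of c a] anti[of c b] unfolding lin by auto
  then have s0: "\<omega> s y = 0" if "y \<in> S" for y
    using real_vector.linear_eq_0_on_span[OF right] B(3) that by blast
  have in_S: "a \<in> S" "b \<in> S" "c \<in> S" using B(1) abc(1) by simp_all
  have "a \<noteq> 0" using B(2) abc(1) real_vector.dependent_zero by blast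
  have s_in: "s \<in> S"
    unfolding s_def by (intro subspace_add subspace_diff subspace_scale S(1) in_S)
  show thesis
  proof (cases "s = 0")
    case False
    then show thesis using that s0 s_in by blast
  next
    case True
    \<comment> \<open>By independence all coefficients of \<open>s\<close> vanish, that is, \<open>\<omega>\<close> is zero on \<open>S\<close>.\<close>
    define u where "u v = (if v = a then \<omega> b c else if v = b then - \<omega> a c else \<omega> a b)" for v
    have "(\<Sum>v\<in>B. u v *\<^sub>R v) = 0"
      using abc True by (simp add: u_def s_def algebra_simps)
    then have "u v = 0" if "v \<in> B" for v
      using real_vector.independentD[OF B(2) _ order_refl _ that] abc(1) by auto
    from this[of b] this[of c] have "\<omega> a b = 0" "\<omega> a c = 0"
      using abc by (auto simp: u_def)
    then have "\<omega> a y = 0" if "y \<in> B" for y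
      using that abc skew by auto
    then have "\<omega> a y = 0" if "y \<in> S" for y
      using real_vector.linear_eq_0_on_span[OF right] B(3) that by blast
    then show thesis using that in_S(1) \<open>a \<noteq> 0\<close> by blast
  qed
qed

section \<open>Three-dimensional semisimple Lie algebras\<close>

context lie_algebra
begin

lemma br_span_singleton: "x \<in> span {e} \<Longrightarrow> y \<in> span {e} \<Longrightarrow> br x y = 0"
  by (auto simp: real_vector.span_singleton linear_scale[OF linear_left]
      linear_scale[OF linear_right] self)

lemma br_span_pair:
  assumes "x \<in> span {e, f}" "y \<in> span {e, f}"
  shows "br x y \<in> span {br e f}"
proof -
  obtain a b where x: "x = a *\<^sub>R e + b *\<^sub>R f"
    using assms(1) by (auto simp: real_vector.span_insert diff_eq_eq add.commute)
  obtain c d where y: "y = c *\<^sub>R e + d *\<^sub>R f"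
    using assms(2) by (auto simp: real_vector.span_insert diff_eq_eq add.commute)
  have "br x y = (a * d - b * c) *\<^sub>R br e f"
    unfolding x y
    by (simp add: linear_add[OF linear_left] linear_add[OF linear_right]
        linear_scale[OF linear_left] linear_scale[OF linear_right] self br_swap[of f e]
        algebra_simps)
  then show ?thesis by (simp add: real_vector.span_base real_vector.span_scale)
qed

text \<open>By alternation the brackets within a plane span at most a line, and those within a line
  vanish.\<close>

lemma lie_solvable_if_derived_in_plane:
  assumes "derived_series br U 1 \<subseteq> span {e, f}"
  shows "lie_solvable br U"
proof -
  have 2: "derived_series br U 2 \<subseteq> span {br e f}"
    unfolding numeral_2_eq_2 derived_series.simps(2)[of br U "Suc 0"]
  proof (rule real_vector.span_minimal[OF subsetI real_vector.subspace_span])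
    fix u assume "u \<in> {br x y | x y. x \<in> derived_series br U (Suc 0) \<and> y \<in> derived_series br U (Suc 0)}"
    then obtain x y where u: "u = br x y"
      and "x \<in> derived_series br U 1" "y \<in> derived_series br U 1"
      by auto
    then show "u \<in> span {br e f}"
      unfolding u using assms by (intro br_span_pair) blast+
  qed
  have "{br x y | x y. x \<in> derived_series br U 2 \<and> y \<in> derived_series br U 2} \<subseteq> {0}"
    using 2 br_span_singleton by blast
  then have "derived_series br U 3 \<subseteq> {0}"
    unfolding numeral_3_eq_3 derived_series.simps(2)[of br U "Suc (Suc 0)"] numeral_2_eq_2
    by (intro real_vector.span_minimal) auto
  moreover have "0 \<in> derived_series br U 3"
    by (simp add: numeral_3_eq_3 real_vector.span_zero)
  ultimately show ?thesis unfolding lie_solvable_def by blast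
qed

text \<open>Otherwise the derived algebra has dimension at most two, so that \<open>S\<close> would be a solvable ideal
  of itself.\<close>

lemma semisimple_dim_3_perfect:
  assumes S: "lie_subalgebra br S" "lie_semisimple br S" "dim S = 3"
  shows "S = span {br x y | x y. x \<in> S \<and> y \<in> S}" (is "S = ?D")
proof (rule ccontr)
  assume ne: "S \<noteq> ?D"
  have sub: "?D \<subseteq> S"
    using S(1) by (intro real_vector.span_minimal) (auto simp: lie_subalgebra_def)
  obtain B where B: "B \<subseteq> ?D" "independent B" "?D \<subseteq> span B" "card B = dim ?D"
    by (rule real_vector.basis_exists)
  obtain C where C: "C \<subseteq> S" "independent C" "S \<subseteq> span C" "card C = dim S"
    by (rule real_vector.basis_exists)
  have "finite C" by (rule card_ge_0_finite) (use C(4) S(3) in linarith)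
  moreover have "B \<subseteq> span C" using B(1) sub C(3) by blast
  ultimately have "finite B \<and> card B \<le> card C"
    by (rule real_vector.independent_span_bound[OF _ B(2)])
  then have fin: "finite B" "card B \<le> 3" using C(4) S(3) by simp_all
  have "card B \<noteq> 3"
  proof
    assume "card B = 3"
    then have "S \<subseteq> span B"
      by (intro independent_card_eq_dim_spans[OF B(2) order_trans[OF B(1) sub]])
        (simp_all add: S(3) \<open>card B = 3\<close>)
    also have "\<dots> \<subseteq> ?D"
      using B(1) real_vector.subspace_span by (rule real_vector.span_minimal)
    finally show False using ne sub by blast
  qed
  then have "card B \<le> 2" using fin by simp
  then obtain e f where "B \<subseteq> {e, f}"
  proof -
    consider "card B = 0" | "card B = 1" | "card B = 2" using \<open>card B \<le> 2\<close> by linarith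
    then show thesis
      using that fin(1) by cases (auto simp: card_1_singleton_iff card_2_iff)
  qed
  then have "derived_series br S 1 \<subseteq> span {e, f}"
    using B(3) real_vector.span_mono[of B "{e, f}"] by auto
  then have "lie_solvable br S" by (rule lie_solvable_if_derived_in_plane)
  moreover have "lie_ideal br S S"
    using S(1) by (simp add: lie_ideal_def lie_subalgebra_def)
  ultimately have "S = {0}" using S(2) by (auto simp: lie_semisimple_def)
  then have "dim S = 0" using real_vector.dim_le_card[of S "{}"] by simp
  then show False using S(3) by simp
qed

text \<open>Every other term of the differential of \<open>\<phi>\<close> at \<open>[z, x, y, r]\<close> contains a vanishing
  bracket.\<close>

lemma closed_form_central_contraction:
  assumes \<phi>: "\<phi> \<in> alt_forms 3" "closed_form br 3 \<phi>"
    and z: "\<And>x. br z x = 0" and r: "br x r = 0" "br y r = 0"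
  shows "\<phi> [z, br x y, r] = 0"
proof -
  have zero: "\<phi> [0, u, v] = 0" for u v
    using linear_0[OF alt_forms_linear[OF \<phi>(1), of "[0, u, v]" 0]] by simp
  have "ce_d br 3 \<phi> [z, x, y, r] = 0" using \<phi>(2) by (simp add: closed_form_def)
  then have "\<phi> [br x y, z, r] = 0" by (simp add: ce_d_3 z r zero)
  then show ?thesis
    using alt_forms_swap[OF \<phi>(1), of "[z, br x y, r]" 0 1 z "br x y"] by simp
qed

end

theorem lemma4p5:
  fixes br :: "'a::real_vector \<Rightarrow> 'a \<Rightarrow> 'a" and S R :: "'a set"
  assumes "lie_algebra br"
    and "dim (UNIV :: 'a set) = 7"
    and "lie_direct_sum br S R"
    and "lie_semisimple br S" and "dim S = 3"
    and "lie_solvable br R" and "dim R = 4"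
    and "lie_center br R \<noteq> {0}"
  shows "\<not> (\<exists>\<phi>. G2_structure \<phi> \<and> closed_form br 3 \<phi>)"
proof
  assume "\<exists>\<phi>. G2_structure \<phi> \<and> closed_form br 3 \<phi>"
  then obtain \<phi> where G2: "G2_structure \<phi>" and closed: "closed_form br 3 \<phi>" by blast
  then have \<phi>: "\<phi> \<in> alt_forms 3" by (simp add: G2_structure_def stable_form_def)
  interpret lie_algebra br by fact
  have S: "lie_subalgebra br S" "subspace S" and R: "subspace R"
    and comm: "\<And>x y. x \<in> S \<Longrightarrow> y \<in> R \<Longrightarrow> br x y = 0"
    and disj: "S \<inter> R = {0}" and sum: "{x + y | x y. x \<in> S \<and> y \<in> R} = UNIV"
    using assms(3) by (auto simp: lie_direct_sum_def lie_subalgebra_def)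
  have "0 \<in> lie_center br R"
    using R by (simp add: lie_center_def subspace_0 linear_0[OF linear_left])
  then obtain z where z: "z \<in> R" "z \<noteq> 0" "\<And>y. y \<in> R \<Longrightarrow> br z y = 0"
    using assms(8) by (auto simp: lie_center_def)
  have central: "br z u = 0" for u
  proof -
    obtain x y where "u = x + y" "x \<in> S" "y \<in> R" using sum by blast
    then show ?thesis
      using comm[OF _ z(1), of x] z(3)[of y] br_swap[of z x] by (simp add: linear_add[OF linear_right])
  qed
  define \<omega> where "\<omega> x y = \<phi> [z, x, y]" for x y
  have left: "linear (\<lambda>x. \<omega> x y)" for y
    using alt_forms_linear[OF \<phi>, of "[z, 0, y]" 1] by (simp add: \<omega>_def)
  have right: "linear (\<omega> x)" for x
    using alt_forms_linear[OF \<phi>, of "[z, x, 0]" 2] by (simp add: \<omega>_def[abs_def] numeral_2_eq_2)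
  have skew: "\<omega> x x = 0" for x
    using alt_forms_repeated[OF \<phi>, of "[z, x, x]" 1 2] by (simp add: \<omega>_def)
  have mixed: "\<omega> x r = 0" if "x \<in> S" "r \<in> R" for x r
  proof (rule real_vector.linear_eq_0_on_span[OF left])
    show "x \<in> span {br x y | x y. x \<in> S \<and> y \<in> S}"
      using semisimple_dim_3_perfect[OF S(1) assms(4,5)] that(1) by simp
    show "\<omega> u r = 0" if "u \<in> {br x y | x y. x \<in> S \<and> y \<in> S}" for u
      using that closed_form_central_contraction[OF \<phi> closed central] comm \<open>r \<in> R\<close>
      by (auto simp: \<omega>_def)
  qed
  obtain s where s: "s \<in> S" "s \<noteq> 0" "\<And>y. y \<in> S \<Longrightarrow> \<omega> s y = 0"
    using skew_form_dim_3_kernel[OF left right skew S(2) assms(5)] by blast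
  have "\<omega> s w = 0" for w
  proof -
    obtain x y where "w = x + y" "x \<in> S" "y \<in> R" using sum by blast
    then show ?thesis
      using s mixed by (simp add: linear_add[OF right])
  qed
  moreover have "z \<notin> span {s}"
    using real_vector.span_minimal[of "{s}" S] s(1) S(2) z(1,2) disj by blast
  ultimately show False
    using G2_structure_nondegenerate[OF G2 s(2)] by (auto simp: \<omega>_def)
qed

end
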